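(* Let $(X,\mathcal{A})$ be a measurable space and let $S(X,\mathcal{A})$ be a $\chi$-ring. Let $\mathcal{M}_S$ be the set of all maximal ideals of $S(X,\mathcal{A})$ with the hull-kernel topology $\tau_S$, and let $\mathcal{U}_X$ be the set of all $\mathcal{A}$-ultrafilters on $X$ with the Stone topology $\tau$. Define an equivalence relation on $\mathcal{M}_S$ by $M\sim N$ if and only if $\mathcal{Z}_S[M]=\mathcal{Z}_S[N]$, and equip $\mathcal{M}_S/\sim$ with the quotient topology $\tau_q$ induced from $(\mathcal{M}_S,\tau_S)$ by the natural map $M\mapsto[M]$. Then the map $\mathcal{Z}_S^0:(\mathcal{M}_S/\sim,\tau_q)\to(\mathcal{U}_X,\tau)$, $\mathcal{Z}_S^0([M])=\mathcal{Z}_S[M]$, is a homeomorphism.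
   Context: A measurable space $(X,\mathcal{A})$ is a nonempty set $X$ with a $\sigma$-algebra $\mathcal{A}$ of subsets of $X$. $\mathcal{M}(X,\mathcal{A})$ is the commutative ring (pointwise operations) of all $\mathcal{A}$-measurable functions $X\to\mathbb{R}$. A $\chi$-ring $S(X,\mathcal{A})$ is a subring of $\mathcal{M}(X,\mathcal{A})$ such that $\chi_A\in S(X,\mathcal{A})$ for every $A\in\mathcal{A}$, where $\chi_A$ is the characteristic function of $A$. For $f\in S(X,\mathcal{A})$, $\mathcal{Z}_S(f)=\{E\in\mathcal{A}: \text{there exists } g\in S(X,\mathcal{A}) \text{ with } f(x)g(x)=1 \text{ for all } x\in X\setminus E\}$; for a proper ideal $I$, $\mathcal{Z}_S[I]=\bigcup_{f\in I}\mathcal{Z}_S(f)$. An $\mathcal{A}$-filter on $X$ is a nonempty family of members of $\mathcal{A}$ not containing $\emptyset$, closed under finite intersections and under supersets belonging to $\mathcal{A}$; an $\mathcal{A}$-ultrafilter is a maximal $\mathcal{A}$-filter. For every maximal ideal $M$, $\mathcal{Z}_S[M]$ is an $\mathcal{A}$-ultrafilter. The hull-kernel topology $\tau_S$ on $\mathcal{M}_S$ has as a base for closed sets the sets $\mathcal{M}_f=\{M\in\mathcal{M}_S: f\in M\}$, $f\in S(X,\mathcal{A})$. The Stone topology $\tau$ on $\mathcal{U}_X$ has as a base for closed sets the sets $S_E=\{\mathcal{U}\in\mathcal{U}_X: E\in\mathcal{U}\}$, $E\in\mathcal{A}$. *)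

theory Defs
  imports "HOL-Analysis.Analysis" "HOL-Algebra.Subrings"
begin

section \<open>Two constructions on topologies\<close>

text \<open>The topology on \<open>T\<close> whose closed sets are the intersections \<open>T \<inter> \<Inter>D\<close> with
  \<open>D \<subseteq> C\<close>. This is a topology on \<open>T\<close> when \<open>C\<close> really is a base for closed sets; see
  \<open>topology_of_closed_base\<close> below for a sufficient condition.\<close>

definition closed_base_topology :: "'a set \<Rightarrow> 'a set set \<Rightarrow> 'a topology" where
  "closed_base_topology T C = topology (\<lambda>U. \<exists>D\<subseteq>C. U = T - \<Inter>D)"

lemma topology_of_closed_base:
  assumes emp: "{} \<in> C" and un: "\<And>A B. A \<in> C \<Longrightarrow> B \<in> C \<Longrightarrow> A \<union> B \<in> C"
  shows openin_closed_base_topology: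
      "openin (closed_base_topology T C) U \<longleftrightarrow> (\<exists>D\<subseteq>C. U = T - \<Inter>D)"
    and topspace_closed_base_topology: "topspace (closed_base_topology T C) = T"
    and closedin_closed_base_topology:
      "closedin (closed_base_topology T C) K \<longleftrightarrow> (\<exists>D\<subseteq>C. K = T \<inter> \<Inter>D)"
proof -
  have ist: "istopology (\<lambda>U. \<exists>D\<subseteq>C. U = T - \<Inter>D)"
    unfolding istopology_def
  proof (intro conjI allI impI)
    fix U V assume "\<exists>D\<subseteq>C. U = T - \<Inter>D" "\<exists>D\<subseteq>C. V = T - \<Inter>D"
    then obtain D1 D2 where D: "D1 \<subseteq> C" "U = T - \<Inter>D1" "D2 \<subseteq> C" "V = T - \<Inter>D2"
      by blast
    let ?D = "{A \<union> B |A B. A \<in> D1 \<and> B \<in> D2}"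
    have "?D \<subseteq> C" using un D by blast
    moreover have "U \<inter> V = T - \<Inter>?D" unfolding D by blast
    ultimately show "\<exists>D\<subseteq>C. U \<inter> V = T - \<Inter>D" by blast
  next
    fix \<K> assume "\<forall>K\<in>\<K>. \<exists>D\<subseteq>C. K = T - \<Inter>D"
    then obtain d where d: "\<And>K. K \<in> \<K> \<Longrightarrow> d K \<subseteq> C \<and> K = T - \<Inter>(d K)" by metis
    have "\<Union>\<K> = (\<Union>K\<in>\<K>. T - \<Inter>(d K))" using d by auto
    also have "\<dots> = T - \<Inter>(\<Union>K\<in>\<K>. d K)" by blast
    finally have "\<Union>\<K> = T - \<Inter>(\<Union>K\<in>\<K>. d K)" .
    moreover have "(\<Union>K\<in>\<K>. d K) \<subseteq> C" using d by blast
    ultimately show "\<exists>D\<subseteq>C. \<Union>\<K> = T - \<Inter>D" by blast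
  qed
  show o: "openin (closed_base_topology T C) U \<longleftrightarrow> (\<exists>D\<subseteq>C. U = T - \<Inter>D)" for U
    unfolding closed_base_topology_def using topology_inverse'[OF ist] by simp
  have "openin (closed_base_topology T C) T"
    unfolding o using emp by (intro exI[of _ "{{}}"]) auto
  moreover have "topspace (closed_base_topology T C) \<subseteq> T"
    unfolding topspace_def using o by blast
  ultimately show t: "topspace (closed_base_topology T C) = T"
    using openin_subset by blast
  show "closedin (closed_base_topology T C) K \<longleftrightarrow> (\<exists>D\<subseteq>C. K = T \<inter> \<Inter>D)"
  proof
    assume "closedin (closed_base_topology T C) K"
    then obtain D where "D \<subseteq> C" "K \<subseteq> T" "T - K = T - \<Inter>D"
      unfolding closedin_def t o by blast
    then have "K = T \<inter> \<Inter>D" by blast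
    then show "\<exists>D\<subseteq>C. K = T \<inter> \<Inter>D" using \<open>D \<subseteq> C\<close> by blast
  next
    assume "\<exists>D\<subseteq>C. K = T \<inter> \<Inter>D"
    then obtain D where "D \<subseteq> C" "K = T \<inter> \<Inter>D" by blast
    then have "T - K = T - \<Inter>D" "K \<subseteq> T" by auto
    then show "closedin (closed_base_topology T C) K"
      unfolding closedin_def t o using \<open>D \<subseteq> C\<close> by blast
  qed
qed

definition quotient_topology :: "'a topology \<Rightarrow> ('a \<times> 'a) set \<Rightarrow> 'a set topology" where
  "quotient_topology T r =
     topology (\<lambda>U. U \<subseteq> topspace T // r \<and> openin T {x \<in> topspace T. r `` {x} \<in> U})"

lemma openin_quotient_topology:
  "openin (quotient_topology T r) U \<longleftrightarrow>
     U \<subseteq> topspace T // r \<and> openin T {x \<in> topspace T. r `` {x} \<in> U}"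
proof -
  have "istopology (\<lambda>U. U \<subseteq> topspace T // r \<and> openin T {x \<in> topspace T. r `` {x} \<in> U})"
    unfolding istopology_def
  proof (intro conjI allI impI; (elim conjE)?)
    fix U V
    assume "openin T {x \<in> topspace T. r `` {x} \<in> U}" "openin T {x \<in> topspace T. r `` {x} \<in> V}"
    then have "openin T ({x \<in> topspace T. r `` {x} \<in> U} \<inter> {x \<in> topspace T. r `` {x} \<in> V})"
      by (rule openin_Int)
    then show "openin T {x \<in> topspace T. r `` {x} \<in> U \<inter> V}"
      by (rule back_subst[of "openin T"]) auto
  next
    fix \<K>
    assume "\<forall>K\<in>\<K>. K \<subseteq> topspace T // r \<and> openin T {x \<in> topspace T. r `` {x} \<in> K}"
    then have "openin T (\<Union>K\<in>\<K>. {x \<in> topspace T. r `` {x} \<in> K})" by auto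
    then show "openin T {x \<in> topspace T. r `` {x} \<in> \<Union>\<K>}"
      by (rule back_subst[of "openin T"]) auto
  qed auto
  then show ?thesis unfolding quotient_topology_def by (simp add: topology_inverse')
qed

lemma topspace_quotient_topology: "topspace (quotient_topology T r) = topspace T // r"
proof -
  have "{x \<in> topspace T. r `` {x} \<in> topspace T // r} = topspace T" by (auto intro: quotientI)
  then have "openin (quotient_topology T r) (topspace T // r)"
    unfolding openin_quotient_topology by simp
  moreover have "topspace (quotient_topology T r) \<subseteq> topspace T // r"
    unfolding topspace_def[of "quotient_topology T r"] openin_quotient_topology by blast
  ultimately show ?thesis using openin_subset by blast
qed

lemma quotient_map_quotient_topology: "quotient_map T (quotient_topology T r) (\<lambda>x. r `` {x})"
  unfolding quotient_map_def topspace_quotient_topology openin_quotient_topology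
  by (auto simp: quotient_def)


section \<open>\<open>\<chi>\<close>-rings\<close>

text \<open>A measurable space is a value \<open>X\<close> of type \<^typ>\<open>'a measure\<close>, of which only \<open>space X\<close> and
  \<open>sets X\<close> are used. Functions on \<open>space X\<close> are represented by their extensional versions, so
  that equality of ring elements is equality of functions on \<open>space X\<close>.\<close>

definition measurable_ring :: "'a measure \<Rightarrow> ('a \<Rightarrow> real) ring" where
  "measurable_ring X =
     \<lparr>carrier = borel_measurable X \<inter> extensional (space X),
      mult = (\<lambda>f g. \<lambda>x\<in>space X. f x * g x),
      one = (\<lambda>x\<in>space X. 1),
      zero = (\<lambda>x\<in>space X. 0),
      add = (\<lambda>f g. \<lambda>x\<in>space X. f x + g x)\<rparr>"

definition char_fun :: "'a measure \<Rightarrow> 'a set \<Rightarrow> 'a \<Rightarrow> real" where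
  "char_fun X A = (\<lambda>x\<in>space X. indicator A x)"

definition chi_ring :: "'a measure \<Rightarrow> ('a \<Rightarrow> real) set \<Rightarrow> bool" where
  "chi_ring X S \<longleftrightarrow> subring S (measurable_ring X) \<and> (\<forall>A\<in>sets X. char_fun X A \<in> S)"

definition ring_of :: "'a measure \<Rightarrow> ('a \<Rightarrow> real) set \<Rightarrow> ('a \<Rightarrow> real) ring" where
  "ring_of X S = (measurable_ring X)\<lparr>carrier := S\<rparr>"

definition max_ideals :: "'a measure \<Rightarrow> ('a \<Rightarrow> real) set \<Rightarrow> ('a \<Rightarrow> real) set set" where
  "max_ideals X S = {M. maximalideal M (ring_of X S)}"

definition hull_kernel_topology ::
    "'a measure \<Rightarrow> ('a \<Rightarrow> real) set \<Rightarrow> ('a \<Rightarrow> real) set topology" where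
  "hull_kernel_topology X S =
     closed_base_topology (max_ideals X S) ((\<lambda>f. {M \<in> max_ideals X S. f \<in> M}) ` S)"

definition Z_fun :: "'a measure \<Rightarrow> ('a \<Rightarrow> real) set \<Rightarrow> ('a \<Rightarrow> real) \<Rightarrow> 'a set set" where
  "Z_fun X S f = {E \<in> sets X. \<exists>g\<in>S. \<forall>x\<in>space X - E. f x * g x = 1}"

definition Z_ideal :: "'a measure \<Rightarrow> ('a \<Rightarrow> real) set \<Rightarrow> ('a \<Rightarrow> real) set \<Rightarrow> 'a set set" where
  "Z_ideal X S I = (\<Union>f\<in>I. Z_fun X S f)"

definition Z_rel ::
    "'a measure \<Rightarrow> ('a \<Rightarrow> real) set \<Rightarrow> (('a \<Rightarrow> real) set \<times> ('a \<Rightarrow> real) set) set" where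
  "Z_rel X S = {(M, N). M \<in> max_ideals X S \<and> N \<in> max_ideals X S \<and> Z_ideal X S M = Z_ideal X S N}"

text \<open>On a class \<open>[M]\<close> the image below is the singleton of \<open>Z_ideal X S M\<close>; see
  \<open>Z_quot_class\<close>.\<close>

definition Z_quot :: "'a measure \<Rightarrow> ('a \<Rightarrow> real) set \<Rightarrow> ('a \<Rightarrow> real) set set \<Rightarrow> 'a set set" where
  "Z_quot X S c = the_elem (Z_ideal X S ` c)"

lemma equiv_Z_rel: "equiv (max_ideals X S) (Z_rel X S)"
  by (auto simp: equiv_def refl_on_def sym_def trans_def Z_rel_def)

lemma Z_quot_class:
  assumes "M \<in> max_ideals X S"
  shows "Z_quot X S (Z_rel X S `` {M}) = Z_ideal X S M"
proof -
  have "Z_ideal X S ` (Z_rel X S `` {M}) = {Z_ideal X S M}"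
    using assms by (auto simp: Z_rel_def)
  then show ?thesis by (simp add: Z_quot_def)
qed


section \<open>Ultrafilters of measurable sets\<close>

definition set_filter :: "'a measure \<Rightarrow> 'a set set \<Rightarrow> bool" where
  "set_filter X F \<longleftrightarrow> F \<subseteq> sets X \<and> F \<noteq> {} \<and> {} \<notin> F \<and>
     (\<forall>A\<in>F. \<forall>B\<in>F. A \<inter> B \<in> F) \<and> (\<forall>A\<in>F. \<forall>B\<in>sets X. A \<subseteq> B \<longrightarrow> B \<in> F)"

definition ultrafilters :: "'a measure \<Rightarrow> 'a set set set" where
  "ultrafilters X = {U. set_filter X U \<and> (\<forall>F. set_filter X F \<and> U \<subseteq> F \<longrightarrow> F = U)}"

definition stone_topology :: "'a measure \<Rightarrow> 'a set set topology" where
  "stone_topology X =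
     closed_base_topology (ultrafilters X) ((\<lambda>E. {U \<in> ultrafilters X. E \<in> U}) ` sets X)"


section \<open>The two families are bases for closed sets\<close>

lemma cring_measurable_ring: "cring (measurable_ring X)"
proof -
  let ?R = "measurable_ring X"
  have mem: "(\<lambda>x\<in>space X. h x) \<in> carrier ?R" if "h \<in> borel_measurable X" for h :: "'a \<Rightarrow> real"
  proof -
    have "(\<lambda>x\<in>space X. h x) \<in> borel_measurable X"
      using that measurable_restrict_space_iff measurable_cong[of X "\<lambda>x\<in>space X. h x" h borel] by simp
    then show ?thesis by (simp add: measurable_ring_def)
  qed
  have car: "f \<in> borel_measurable X" "f \<in> extensional (space X)" if "f \<in> carrier ?R" for f
    using that by (auto simp: measurable_ring_def)
  have eqI: "f = g" if "f \<in> extensional (space X)" "g \<in> extensional (space X)"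
    "\<And>x. x \<in> space X \<Longrightarrow> f x = g x" for f g :: "'a \<Rightarrow> real"
    using that by (rule extensionalityI)
  have ops: "f \<oplus>\<^bsub>?R\<^esub> g = (\<lambda>x\<in>space X. f x + g x)" "f \<otimes>\<^bsub>?R\<^esub> g = (\<lambda>x\<in>space X. f x * g x)"
    "\<zero>\<^bsub>?R\<^esub> = (\<lambda>x\<in>space X. 0)" "\<one>\<^bsub>?R\<^esub> = (\<lambda>x\<in>space X. 1)" for f g
    by (simp_all add: measurable_ring_def)
  have add: "f \<oplus>\<^bsub>?R\<^esub> g \<in> carrier ?R" and mult: "f \<otimes>\<^bsub>?R\<^esub> g \<in> carrier ?R"
    if "f \<in> carrier ?R" "g \<in> carrier ?R" for f g
    unfolding ops using car(1)[OF that(1)] car(1)[OF that(2)]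
    by (auto intro!: mem)
  have zero: "\<zero>\<^bsub>?R\<^esub> \<in> carrier ?R" and one: "\<one>\<^bsub>?R\<^esub> \<in> carrier ?R"
    unfolding ops by (auto intro!: mem)
  have uminus: "\<exists>g\<in>carrier ?R. g \<oplus>\<^bsub>?R\<^esub> f = \<zero>\<^bsub>?R\<^esub>" if "f \<in> carrier ?R" for f
  proof (rule bexI)
    show "(\<lambda>x\<in>space X. - f x) \<in> carrier ?R" using car(1)[OF that] by (auto intro!: mem)
    show "(\<lambda>x\<in>space X. - f x) \<oplus>\<^bsub>?R\<^esub> f = \<zero>\<^bsub>?R\<^esub>" unfolding ops by (rule eqI) auto
  qed
  show ?thesis
  proof (rule cringI)
    show "abelian_group ?R"
    proof (rule abelian_groupI)
      fix f g h assume fgh: "f \<in> carrier ?R" "g \<in> carrier ?R" "h \<in> carrier ?R"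
      show "f \<oplus>\<^bsub>?R\<^esub> g \<oplus>\<^bsub>?R\<^esub> h = f \<oplus>\<^bsub>?R\<^esub> (g \<oplus>\<^bsub>?R\<^esub> h)"
        unfolding ops by (rule eqI) auto
    next
      fix f g assume "f \<in> carrier ?R" "g \<in> carrier ?R"
      show "f \<oplus>\<^bsub>?R\<^esub> g = g \<oplus>\<^bsub>?R\<^esub> f" unfolding ops by (rule eqI) auto
    next
      fix f assume "f \<in> carrier ?R"
      then show "\<zero>\<^bsub>?R\<^esub> \<oplus>\<^bsub>?R\<^esub> f = f" unfolding ops by (intro eqI) (auto dest: car)
    qed (fact add zero uminus)+
    show "comm_monoid ?R"
    proof (rule comm_monoidI)
      fix f g h assume fgh: "f \<in> carrier ?R" "g \<in> carrier ?R" "h \<in> carrier ?R"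
      show "f \<otimes>\<^bsub>?R\<^esub> g \<otimes>\<^bsub>?R\<^esub> h = f \<otimes>\<^bsub>?R\<^esub> (g \<otimes>\<^bsub>?R\<^esub> h)"
        unfolding ops by (rule eqI) auto
    next
      fix f g assume "f \<in> carrier ?R" "g \<in> carrier ?R"
      show "f \<otimes>\<^bsub>?R\<^esub> g = g \<otimes>\<^bsub>?R\<^esub> f" unfolding ops by (rule eqI) auto
    next
      fix f assume "f \<in> carrier ?R"
      then show "\<one>\<^bsub>?R\<^esub> \<otimes>\<^bsub>?R\<^esub> f = f" unfolding ops by (intro eqI) (auto dest: car)
    qed (fact mult one)+
    fix f g h assume fgh: "f \<in> carrier ?R" "g \<in> carrier ?R" "h \<in> carrier ?R"
    show "(f \<oplus>\<^bsub>?R\<^esub> g) \<otimes>\<^bsub>?R\<^esub> h = f \<otimes>\<^bsub>?R\<^esub> h \<oplus>\<^bsub>?R\<^esub> g \<otimes>\<^bsub>?R\<^esub> h"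
      unfolding ops by (rule eqI) (auto simp: distrib_right)
  qed
qed

lemma cring_ring_of:
  assumes "chi_ring X S"
  shows "cring (ring_of X S)"
proof -
  interpret cring "measurable_ring X" by (rule cring_measurable_ring)
  have S: "subring S (measurable_ring X)" using assms by (simp add: chi_ring_def)
  then have "subcring S (measurable_ring X)" by (rule subcringI')
  then show ?thesis
    using subcring_iff[OF subringE(1)[OF S]] by (simp add: ring_of_def)
qed

lemma
  assumes S: "chi_ring X S"
  shows topspace_hull_kernel_topology: "topspace (hull_kernel_topology X S) = max_ideals X S"
    and closedin_hull_kernel_topology: "closedin (hull_kernel_topology X S) K \<longleftrightarrow>
      (\<exists>D\<subseteq>(\<lambda>f. {M \<in> max_ideals X S. f \<in> M}) ` S. K = max_ideals X S \<inter> \<Inter>D)"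
proof -
  let ?R = "ring_of X S" and ?C = "(\<lambda>f. {M \<in> max_ideals X S. f \<in> M}) ` S"
  interpret R: cring ?R by (rule cring_ring_of[OF S])
  have car: "carrier ?R = S" by (simp add: ring_of_def)
  have prime: "primeideal M ?R" if "M \<in> max_ideals X S" for M
    using that R.maximalideal_prime by (simp add: max_ideals_def)
  have emp: "{} \<in> ?C"
  proof (rule image_eqI)
    show "{} = {M \<in> max_ideals X S. \<one>\<^bsub>?R\<^esub> \<in> M}"
      using prime
      by (auto dest: primeideal.I_notcarr ideal.one_imp_carrier[OF primeideal.axioms(1)])
  qed (use R.one_closed car in simp)
  have un: "A \<union> B \<in> ?C" if AB: "A \<in> ?C" "B \<in> ?C" for A B
  proof -
    obtain f g where f: "f \<in> S" "A = {M \<in> max_ideals X S. f \<in> M}"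
      and g: "g \<in> S" "B = {M \<in> max_ideals X S. g \<in> M}" using AB by blast
    have "f \<otimes>\<^bsub>?R\<^esub> g \<in> M \<longleftrightarrow> f \<in> M \<or> g \<in> M" if M: "M \<in> max_ideals X S" for M
    proof -
      interpret primeideal M ?R by (rule prime[OF M])
      show ?thesis
        using I_prime[of f g] I_l_closed[of g f] I_r_closed[of f g] f(1) g(1) car by auto
    qed
    then have "A \<union> B = {M \<in> max_ideals X S. f \<otimes>\<^bsub>?R\<^esub> g \<in> M}" using f g by blast
    moreover have "f \<otimes>\<^bsub>?R\<^esub> g \<in> S" using R.m_closed f g car by simp
    ultimately show ?thesis by blast
  qed
  show "topspace (hull_kernel_topology X S) = max_ideals X S"
    unfolding hull_kernel_topology_def by (rule topspace_closed_base_topology[OF emp un])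
  show "closedin (hull_kernel_topology X S) K \<longleftrightarrow> (\<exists>D\<subseteq>?C. K = max_ideals X S \<inter> \<Inter>D)"
    unfolding hull_kernel_topology_def by (rule closedin_closed_base_topology[OF emp un])
qed

lemma ultrafilter_Un:
  assumes U: "U \<in> ultrafilters X" and EF: "E \<in> sets X" "F \<in> sets X" "E \<union> F \<in> U"
  shows "E \<in> U \<or> F \<in> U"
proof (rule ccontr)
  assume neg: "\<not> (E \<in> U \<or> F \<in> U)"
  have flt: "set_filter X U" and max: "\<And>G. set_filter X G \<Longrightarrow> U \<subseteq> G \<Longrightarrow> G = U"
    using U by (auto simp: ultrafilters_def)
  let ?G = "{B \<in> sets X. \<exists>A\<in>U. A \<inter> E \<subseteq> B}"
  have "set_filter X ?G"
    unfolding set_filter_def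
  proof (intro conjI)
    show "?G \<noteq> {}" using EF by blast
    show "{} \<notin> ?G"
    proof
      assume "{} \<in> ?G"
      then obtain A where A: "A \<in> U" "A \<inter> E \<subseteq> {}" by blast
      then have "A \<inter> (E \<union> F) \<in> U" "A \<inter> (E \<union> F) \<subseteq> F"
        using EF flt by (auto simp: set_filter_def)
      then have "F \<in> U" using EF(2) flt unfolding set_filter_def by blast
      then show False using neg by simp
    qed
    show "\<forall>A\<in>?G. \<forall>B\<in>?G. A \<inter> B \<in> ?G"
    proof (intro ballI)
      fix B1 B2 assume B: "B1 \<in> ?G" "B2 \<in> ?G"
      then obtain A1 A2 where A: "A1 \<in> U" "A2 \<in> U" "A1 \<inter> E \<subseteq> B1" "A2 \<inter> E \<subseteq> B2" by blast
      have "A1 \<inter> A2 \<in> U" using A flt by (simp add: set_filter_def)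
      moreover have "(A1 \<inter> A2) \<inter> E \<subseteq> B1 \<inter> B2" using A by blast
      moreover have "B1 \<inter> B2 \<in> sets X" using B by auto
      ultimately show "B1 \<inter> B2 \<in> ?G" by blast
    qed
  qed auto
  moreover have "U \<subseteq> ?G" using flt by (auto simp: set_filter_def)
  ultimately have "?G = U" by (rule max)
  moreover have "E \<in> ?G" using EF by blast
  ultimately show False using neg by simp
qed

lemma
  shows topspace_stone_topology: "topspace (stone_topology X) = ultrafilters X"
    and closedin_stone_topology: "closedin (stone_topology X) K \<longleftrightarrow>
      (\<exists>D\<subseteq>(\<lambda>E. {U \<in> ultrafilters X. E \<in> U}) ` sets X. K = ultrafilters X \<inter> \<Inter>D)"
proof -
  let ?C = "(\<lambda>E. {U \<in> ultrafilters X. E \<in> U}) ` sets X"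
  have emp: "{} \<in> ?C"
    by (rule image_eqI[of _ _ "{}"]) (auto simp: ultrafilters_def set_filter_def)
  have un: "A \<union> B \<in> ?C" if AB: "A \<in> ?C" "B \<in> ?C" for A B
  proof -
    obtain E F where E: "E \<in> sets X" "A = {U \<in> ultrafilters X. E \<in> U}"
      and F: "F \<in> sets X" "B = {U \<in> ultrafilters X. F \<in> U}" using AB by blast
    have EF: "E \<union> F \<in> sets X" using E F by simp
    have "E \<union> F \<in> U \<longleftrightarrow> E \<in> U \<or> F \<in> U" if U: "U \<in> ultrafilters X" for U
    proof
      assume "E \<in> U \<or> F \<in> U"
      moreover have "\<And>A B. A \<in> U \<Longrightarrow> B \<in> sets X \<Longrightarrow> A \<subseteq> B \<Longrightarrow> B \<in> U"
        using U unfolding ultrafilters_def set_filter_def by blast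
      ultimately show "E \<union> F \<in> U" using EF by (meson Un_upper1 Un_upper2)
    qed (rule ultrafilter_Un[OF U E(1) F(1)])
    then have "A \<union> B = {U \<in> ultrafilters X. E \<union> F \<in> U}" using E F by blast
    then show ?thesis using EF by blast
  qed
  show "topspace (stone_topology X) = ultrafilters X"
    unfolding stone_topology_def by (rule topspace_closed_base_topology[OF emp un])
  show "closedin (stone_topology X) K \<longleftrightarrow> (\<exists>D\<subseteq>?C. K = ultrafilters X \<inter> \<Inter>D)"
    unfolding stone_topology_def by (rule closedin_closed_base_topology[OF emp un])
qed

end

theory Submission
  imports Defs "HOL-Algebra.Ring_Divisibility"
begin

text \<open>For an ideal \<open>I\<close>, a measurable set \<open>E\<close> belongs to \<open>\<Z>\<^sub>S[I]\<close> iff \<open>I\<close> contains the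
  characteristic function of the complement of \<open>E\<close>; all other elements of \<open>S\<close> can be forgotten. The
  heart of the argument is a lifting property: if \<open>J\<close> is an ideal and \<open>U\<close> is an ultrafilter
  with \<open>\<Z>\<^sub>S[J] \<subseteq> U\<close>, then the functions \<open>f\<close> with \<open>f \<chi>\<^sub>E \<in> J\<close> for some \<open>E \<in> U\<close> form a proper
  ideal, and any maximal ideal \<open>M\<close> above it contains \<open>J\<close> and satisfies \<open>\<Z>\<^sub>S[M] = U\<close>. With
  \<open>J = 0\<close> this gives surjectivity of \<open>M \<mapsto> \<Z>\<^sub>S[M]\<close>; in general it shows that the image of the hull
  of \<open>J\<close> is \<open>{U. \<Z>\<^sub>S[J] \<subseteq> U}\<close>, so the map is closed and therefore a quotient map.\<close>

section \<open>Ideals and maximal ideals in rings\<close>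

lemma (in cring) idealI_cring:
  assumes sub: "I \<subseteq> carrier R" and ne: "I \<noteq> {}"
    and add: "\<And>a b. a \<in> I \<Longrightarrow> b \<in> I \<Longrightarrow> a \<oplus> b \<in> I"
    and mult: "\<And>a r. a \<in> I \<Longrightarrow> r \<in> carrier R \<Longrightarrow> r \<otimes> a \<in> I"
  shows "ideal I R"
proof (rule idealI)
  show "ring R" by (rule ring_axioms)
  show l: "r \<otimes> a \<in> I" if "a \<in> I" "r \<in> carrier R" for a r using that by (rule mult)
  show "a \<otimes> r \<in> I" if "a \<in> I" "r \<in> carrier R" for a r
    using l[OF that] m_comm[of r a] that sub by auto
  show "subgroup I (add_monoid R)"
  proof (rule add.subgroupI)
    fix a assume a: "a \<in> I"
    \<comment> \<open>Multiplying by \<open>\<ominus> \<one>\<close> turns closure under negation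
      into an instance of absorption.\<close>
    then have "\<ominus> a = (\<ominus> \<one>) \<otimes> a" using sub l_minus[of \<one> a] by auto
    then show "\<ominus> a \<in> I" using mult[OF a] by simp
  qed (use sub ne add in auto)
qed

text \<open>Zorn's lemma applies to the ideals above \<open>I\<close> that avoid
  \<open>\<one>\<close>. Avoiding one fixed element passes to unions of chains, and for an ideal it
  is the same as being proper.\<close>

lemma (in ring) exists_maximalideal:
  assumes I: "ideal I R" and one: "\<one> \<notin> I"
  obtains M where "maximalideal M R" "I \<subseteq> M"
proof -
  let ?A = "{J. ideal J R \<and> I \<subseteq> J \<and> \<one> \<notin> J}"
  have Zorn: "\<exists>M\<in>?A. \<forall>J\<in>?A. M \<subseteq> J \<longrightarrow> J = M"
  proof (rule subset_Zorn_nonempty)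
    show "?A \<noteq> {}" using I one by blast
    fix C assume ne: "C \<noteq> {}" and ch: "subset.chain ?A C"
    then have "subset.chain {J. ideal J R} C" by (auto simp: subset.chain_def)
    from chain_Union_is_ideal[OF this] have "ideal (\<Union>C) R" using ne by simp
    then show "\<Union>C \<in> ?A" using ne ch by (auto simp: subset.chain_def)
  qed
  obtain M where "M \<in> ?A" and *: "\<forall>J\<in>?A. M \<subseteq> J \<longrightarrow> J = M"
    by (rule bexE[OF Zorn])
  then have M: "ideal M R" "I \<subseteq> M" "\<one> \<notin> M" by simp_all
  have max: "J = M" if "ideal J R" "I \<subseteq> J" "\<one> \<notin> J" "M \<subseteq> J" for J
    using * that by simp
  have "maximalideal M R"
  proof (rule maximalidealI)
    show "carrier R \<noteq> M" using M(3) one_closed by blast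
    fix J assume J: "ideal J R" "M \<subseteq> J" "J \<subseteq> carrier R"
    then show "J = M \<or> J = carrier R"
      using max[OF J(1) _ _ J(2)] M(2) ideal.one_imp_carrier[OF J(1)] by blast
  qed (rule M(1))
  then show ?thesis using M(2) that by blast
qed

section \<open>Complements and ultrafilters\<close>

text \<open>If a larger filter had a member \<open>E\<close> outside \<open>F\<close>, the dichotomy
  would also put the complement of \<open>E\<close> into it, and the two are disjoint.\<close>

lemma ultrafilterI:
  assumes F: "set_filter X F" and dich: "\<And>E. E \<in> sets X \<Longrightarrow> E \<in> F \<or> space X - E \<in> F"
  shows "F \<in> ultrafilters X"
proof -
  have "G = F" if G: "set_filter X G" "F \<subseteq> G" for G
  proof
    show "G \<subseteq> F"
    proof
      fix E assume E: "E \<in> G"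
      show "E \<in> F"
      proof (rule ccontr)
        assume "E \<notin> F"
        moreover have "E \<in> sets X" using E G by (auto simp: set_filter_def)
        ultimately have "space X - E \<in> G" using dich G(2) by blast
        then have "E \<inter> (space X - E) \<in> G" using E G(1) unfolding set_filter_def by blast
        moreover have "E \<inter> (space X - E) = {}" by blast
        ultimately show False using G(1) by (simp add: set_filter_def)
      qed
    qed
  qed (rule G(2))
  then show ?thesis using F by (auto simp: ultrafilters_def)
qed

text \<open>At least one of the two sets belongs to \<open>U\<close> by
  \<open>ultrafilter_Un\<close>, since their union is the whole space; both cannot, since they are
  disjoint.\<close>

lemma ultrafilter_Compl_iff:
  assumes U: "U \<in> ultrafilters X" and E: "E \<in> sets X"
  shows "space X - E \<in> U \<longleftrightarrow> E \<notin> U"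
proof -
  have F: "set_filter X U" using U by (simp add: ultrafilters_def)
  then obtain A where "A \<in> U" "A \<in> sets X" by (auto simp: set_filter_def)
  then have "space X \<in> U" using F sets.sets_into_space[of A X] unfolding set_filter_def by blast
  moreover have "E \<union> (space X - E) = space X" using E sets.sets_into_space by blast
  ultimately have "E \<in> U \<or> space X - E \<in> U"
    using ultrafilter_Un[OF U E, of "space X - E"] E by auto
  moreover have "\<not> (E \<in> U \<and> space X - E \<in> U)"
  proof
    assume "E \<in> U \<and> space X - E \<in> U"
    then have "E \<inter> (space X - E) \<in> U" using F unfolding set_filter_def by blast
    moreover have "E \<inter> (space X - E) = {}" by blast
    ultimately show False using F by (simp add: set_filter_def)
  qed
  ultimately show ?thesis by blast
qed

section \<open>From ideals to families of measurable sets and back\<close>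

text \<open>These rules reduce ring computations with characteristic functions to set algebra.
  Disjointness in the sum keeps the values in {0, 1}.\<close>

lemma char_fun_ops:
  "char_fun X A \<otimes>\<^bsub>ring_of X S\<^esub> char_fun X B = char_fun X (A \<inter> B)"
  "A \<inter> B = {} \<Longrightarrow> char_fun X A \<oplus>\<^bsub>ring_of X S\<^esub> char_fun X B = char_fun X (A \<union> B)"
  "\<one>\<^bsub>ring_of X S\<^esub> = char_fun X (space X)"
  "\<zero>\<^bsub>ring_of X S\<^esub> = char_fun X {}"
  by (auto simp: ring_of_def measurable_ring_def char_fun_def fun_eq_iff indicator_def)

context
  fixes X :: "'a measure" and S :: "('a \<Rightarrow> real) set"
  assumes chi: "chi_ring X S"
begin

interpretation R: cring "ring_of X S"
  by (rule cring_ring_of[OF chi])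

lemma carrier_ring_of: "carrier (ring_of X S) = S"
  by (simp add: ring_of_def)

lemma char_fun_closed: "A \<in> sets X \<Longrightarrow> char_fun X A \<in> S"
  using chi by (simp add: chi_ring_def)

text \<open>If \<open>g\<close> inverts \<open>f\<close> off \<open>E\<close>, then
  \<open>f g\<close> times the characteristic function of the complement is that function again, so
  it lies in \<open>I\<close> with \<open>f\<close>. Conversely, that function is its own inverse
  off \<open>E\<close>.\<close>

lemma Z_ideal_iff:
  assumes I: "ideal I (ring_of X S)"
  shows "E \<in> Z_ideal X S I \<longleftrightarrow> E \<in> sets X \<and> char_fun X (space X - E) \<in> I"
proof -
  interpret I: ideal I "ring_of X S" by (rule I)
  let ?c = "char_fun X (space X - E)"
  show ?thesis
  proof
    assume "E \<in> Z_ideal X S I"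
    then obtain f g where E: "E \<in> sets X" and f: "f \<in> I" and g: "g \<in> S"
      and fg: "\<And>x. x \<in> space X - E \<Longrightarrow> f x * g x = 1"
      by (auto simp: Z_ideal_def Z_fun_def)
    have "f \<otimes>\<^bsub>ring_of X S\<^esub> g \<otimes>\<^bsub>ring_of X S\<^esub> ?c = ?c"
      using fg
      by (auto simp: ring_of_def measurable_ring_def char_fun_def fun_eq_iff indicator_def)
    moreover have "f \<otimes>\<^bsub>ring_of X S\<^esub> g \<otimes>\<^bsub>ring_of X S\<^esub> ?c \<in> I"
      using f g E char_fun_closed[of "space X - E"]
      by (intro I.I_r_closed) (simp_all add: carrier_ring_of)
    ultimately show "E \<in> sets X \<and> ?c \<in> I" using E by simp
  next
    assume *: "E \<in> sets X \<and> ?c \<in> I"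
    then have "?c \<in> S" using char_fun_closed[OF sets.compl_sets] by simp
    moreover have "\<forall>x\<in>space X - E. ?c x * ?c x = 1" by (simp add: char_fun_def)
    ultimately have "E \<in> Z_fun X S ?c" using * unfolding Z_fun_def by blast
    then show "E \<in> Z_ideal X S I" using * by (auto simp: Z_ideal_def)
  qed
qed

lemma max_idealsD:
  assumes "M \<in> max_ideals X S"
  shows "ideal M (ring_of X S)" "primeideal M (ring_of X S)" "char_fun X (space X) \<notin> M"
proof -
  show "primeideal M (ring_of X S)" using assms R.maximalideal_prime by (simp add: max_ideals_def)
  then show "ideal M (ring_of X S)" by (rule primeideal.axioms(1))
  then show "char_fun X (space X) \<notin> M"
    using ideal.one_imp_carrier[of M "ring_of X S"] primeideal.I_notcarr[of M "ring_of X S"]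
      \<open>primeideal M (ring_of X S)\<close>
    unfolding char_fun_ops(3) by blast
qed

text \<open>Through complements, the filter axioms translate into closure properties of the ideal,
  and the ultrafilter dichotomy into its primeness.\<close>

lemma Z_ideal_ultrafilter:
  assumes M: "M \<in> max_ideals X S"
  shows "Z_ideal X S M \<in> ultrafilters X"
proof (rule ultrafilterI)
  interpret M: primeideal M "ring_of X S" by (rule max_idealsD(2)[OF M])
  note Z = Z_ideal_iff[OF max_idealsD(1)[OF M]]
  have mono: "char_fun X A \<in> M" if "char_fun X B \<in> M" "A \<subseteq> B" "A \<in> sets X" for A B
  proof -
    have "char_fun X A \<otimes>\<^bsub>ring_of X S\<^esub> char_fun X B \<in> M"
      using that char_fun_closed by (intro M.I_l_closed) (auto simp: carrier_ring_of)
    then show ?thesis using that(2) by (simp add: char_fun_ops Int_absorb2)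
  qed
  show "set_filter X (Z_ideal X S M)"
    unfolding set_filter_def
  proof (intro conjI ballI impI)
    show "Z_ideal X S M \<subseteq> sets X" using Z by blast
    have "space X \<in> Z_ideal X S M" using Z[of "space X"] M.zero_closed by (simp add: char_fun_ops)
    then show "Z_ideal X S M \<noteq> {}" by blast
    show "{} \<notin> Z_ideal X S M" using Z[of "{}"] max_idealsD(3)[OF M] by simp
  next
    fix A B assume A: "A \<in> Z_ideal X S M" and B: "B \<in> Z_ideal X S M"
    \<comment> \<open>The complement of \<open>A \<inter> B\<close> is split into the disjoint
      pieces \<open>space X - B\<close> and \<open>B - A\<close>, so that the sum of their
      characteristic functions is again one.\<close>
    have "char_fun X (B - A) \<in> M"
    proof (rule mono)
      show "char_fun X (space X - A) \<in> M" using A Z by blast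
      have *: "A \<in> sets X" "B \<in> sets X" using A B Z by blast+
      then show "B - A \<subseteq> space X - A" using sets.sets_into_space[of B X] by blast
      show "B - A \<in> sets X" using * by simp
    qed
    moreover have "char_fun X (space X - B) \<in> M" using B Z by blast
    ultimately have "char_fun X (space X - B) \<oplus>\<^bsub>ring_of X S\<^esub> char_fun X (B - A) \<in> M"
      by (simp add: M.a_closed)
    then have "char_fun X ((space X - B) \<union> (B - A)) \<in> M"
      by (subst (asm) char_fun_ops(2)) auto
    moreover have "(space X - B) \<union> (B - A) = space X - A \<inter> B"
      using B Z sets.sets_into_space[of B X] by blast
    ultimately have "char_fun X (space X - A \<inter> B) \<in> M" by simp
    moreover have "A \<inter> B \<in> sets X" using A B Z by blast
    ultimately show "A \<inter> B \<in> Z_ideal X S M" using Z by blast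
  next
    fix A B assume A: "A \<in> Z_ideal X S M" and B: "B \<in> sets X" "A \<subseteq> B"
    have "char_fun X (space X - A) \<in> M" using A Z by blast
    moreover have "space X - B \<subseteq> space X - A" "space X - B \<in> sets X" using B by auto
    ultimately have "char_fun X (space X - B) \<in> M" by (rule mono)
    then show "B \<in> Z_ideal X S M" using Z B(1) by blast
  qed
  show "E \<in> Z_ideal X S M \<or> space X - E \<in> Z_ideal X S M" if E: "E \<in> sets X" for E
  proof -
    \<comment> \<open>The product is zero, so primeness puts one of the two factors into
      \<open>M\<close>.\<close>
    have "char_fun X E \<otimes>\<^bsub>ring_of X S\<^esub> char_fun X (space X - E) \<in> M"
      using M.zero_closed by (simp add: char_fun_ops)
    then have "char_fun X E \<in> M \<or> char_fun X (space X - E) \<in> M"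
      using E char_fun_closed by (intro M.I_prime) (auto simp: carrier_ring_of)
    moreover have "space X - (space X - E) = E" using E sets.sets_into_space by blast
    moreover have "space X - E \<in> sets X" using E by simp
    ultimately show ?thesis using E Z[of E] Z[of "space X - E"] by presburger
  qed
qed

lemma Z_ideal_lift:
  assumes J: "ideal J (ring_of X S)" and U: "U \<in> ultrafilters X" and sub: "Z_ideal X S J \<subseteq> U"
  obtains M where "M \<in> max_ideals X S" "J \<subseteq> M" "Z_ideal X S M = U"
proof -
  interpret J: ideal J "ring_of X S" by (rule J)
  have F: "set_filter X U" and max: "\<And>G. set_filter X G \<Longrightarrow> U \<subseteq> G \<Longrightarrow> G = U"
    using U unfolding ultrafilters_def by blast+
  let ?c = "char_fun X" and ?R = "ring_of X S"
  have sets: "E \<in> sets X" if "E \<in> U" for E using that F unfolding set_filter_def by blast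
  have c: "?c E \<in> carrier ?R" if "E \<in> U" for E
    using char_fun_closed[OF sets[OF that]] by (simp add: carrier_ring_of)
  \<comment> \<open>Any member of \<open>U\<close> will do: it witnesses that zero, and later every
    element of \<open>J\<close>, belongs to \<open>?I\<close>.\<close>
  obtain E0 where E0: "E0 \<in> U" using F unfolding set_filter_def by blast
  let ?I = "{f \<in> carrier ?R. \<exists>E\<in>U. f \<otimes>\<^bsub>?R\<^esub> ?c E \<in> J}"
  have ideal: "ideal ?I ?R"
  proof (rule R.idealI_cring)
    show "?I \<noteq> {}" 
    proof -
      have "\<zero>\<^bsub>?R\<^esub> \<otimes>\<^bsub>?R\<^esub> ?c E0 \<in> J" using c[OF E0] J.zero_closed by simp
      then have "\<zero>\<^bsub>?R\<^esub> \<in> ?I" using E0 R.zero_closed by blast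
      then show ?thesis by blast
    qed
  next
    fix f g assume "f \<in> ?I" "g \<in> ?I"
    then obtain A B where f: "f \<in> carrier ?R" and g: "g \<in> carrier ?R"
      and A: "A \<in> U" "f \<otimes>\<^bsub>?R\<^esub> ?c A \<in> J" and B: "B \<in> U" "g \<otimes>\<^bsub>?R\<^esub> ?c B \<in> J" by blast
    \<comment> \<open>Multiplying each product by the other characteristic function gives the common
      witness \<open>A \<inter> B\<close>.\<close>
    have "(f \<otimes>\<^bsub>?R\<^esub> ?c A) \<otimes>\<^bsub>?R\<^esub> ?c B \<oplus>\<^bsub>?R\<^esub> (g \<otimes>\<^bsub>?R\<^esub> ?c B) \<otimes>\<^bsub>?R\<^esub> ?c A \<in> J"
      using J.I_r_closed[OF A(2) c[OF B(1)]] J.I_r_closed[OF B(2) c[OF A(1)]] by (rule J.a_closed)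
    also have "(f \<otimes>\<^bsub>?R\<^esub> ?c A) \<otimes>\<^bsub>?R\<^esub> ?c B \<oplus>\<^bsub>?R\<^esub> (g \<otimes>\<^bsub>?R\<^esub> ?c B) \<otimes>\<^bsub>?R\<^esub> ?c A
        = (f \<oplus>\<^bsub>?R\<^esub> g) \<otimes>\<^bsub>?R\<^esub> (?c A \<otimes>\<^bsub>?R\<^esub> ?c B)"
      using f g c[OF A(1)] c[OF B(1)] by (simp add: R.l_distr R.m_assoc R.m_comm[of "?c B" "?c A"])
    finally have "(f \<oplus>\<^bsub>?R\<^esub> g) \<otimes>\<^bsub>?R\<^esub> ?c (A \<inter> B) \<in> J" by (simp add: char_fun_ops)
    moreover have "A \<inter> B \<in> U" using F A B by (simp add: set_filter_def)
    ultimately show "f \<oplus>\<^bsub>?R\<^esub> g \<in> ?I" using f g by blast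
  next
    fix f r assume "f \<in> ?I" and r: "r \<in> carrier ?R"
    then obtain A where f: "f \<in> carrier ?R" and A: "A \<in> U" "f \<otimes>\<^bsub>?R\<^esub> ?c A \<in> J" by blast
    have "(r \<otimes>\<^bsub>?R\<^esub> f) \<otimes>\<^bsub>?R\<^esub> ?c A \<in> J"
      using J.I_l_closed[OF A(2) r] r f c[OF A(1)] by (simp add: R.m_assoc)
    then show "r \<otimes>\<^bsub>?R\<^esub> f \<in> ?I" using A(1) r f by blast
  qed blast
  \<comment> \<open>This is where \<open>sub\<close> enters: a witness \<open>E\<close> for
    \<open>\<one>\<close> would put the complement of \<open>E\<close> into
    \<open>Z_ideal X S J\<close>, hence into \<open>U\<close> beside \<open>E\<close>.\<close>
  have "\<one>\<^bsub>?R\<^esub> \<notin> ?I"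
  proof
    assume "\<one>\<^bsub>?R\<^esub> \<in> ?I"
    then obtain E where E: "E \<in> U" "\<one>\<^bsub>?R\<^esub> \<otimes>\<^bsub>?R\<^esub> ?c E \<in> J" by blast
    then have "?c E \<in> J" using c by simp
    moreover have "space X - (space X - E) = E" using sets[OF E(1)] sets.sets_into_space by blast
    ultimately have "space X - E \<in> U" using sub Z_ideal_iff[OF J, of "space X - E"] sets.compl_sets[OF sets[OF E(1)]] by auto
    then show False using ultrafilter_Compl_iff[OF U sets] E(1) by blast
  qed
  then obtain M where "maximalideal M ?R" and IM: "?I \<subseteq> M"
    using R.exists_maximalideal[OF ideal] by blast
  then have M: "M \<in> max_ideals X S" by (simp add: max_ideals_def)
  have "J \<subseteq> ?I"
  proof
    fix f assume f: "f \<in> J"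
    then have "f \<otimes>\<^bsub>?R\<^esub> ?c E0 \<in> J" using c[OF E0] by (rule J.I_r_closed)
    then show "f \<in> ?I" using E0 f J.a_subset by blast
  qed
  moreover have "U \<subseteq> Z_ideal X S M"
  proof
    fix E assume E: "E \<in> U"
    have "?c (space X - E) \<in> carrier ?R"
      using char_fun_closed sets[OF E] by (simp add: carrier_ring_of)
    \<comment> \<open>The product is zero, so \<open>E\<close> itself witnesses membership in
      \<open>?I\<close>.\<close>
    moreover have "?c (space X - E) \<otimes>\<^bsub>?R\<^esub> ?c E \<in> J"
      using J.zero_closed by (simp add: char_fun_ops Int_commute)
    ultimately have "?c (space X - E) \<in> M" using E IM by blast
    then show "E \<in> Z_ideal X S M"
      using Z_ideal_iff[OF max_idealsD(1)[OF M]] sets[OF E] by simp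
  qed
  \<comment> \<open>One inclusion suffices, by maximality of \<open>U\<close> among filters.\<close>
  then have "Z_ideal X S M = U"
    using max Z_ideal_ultrafilter[OF M] by (simp add: ultrafilters_def)
  ultimately show ?thesis using that M IM by blast
qed

section \<open>The map \<open>Z_ideal\<close> between the two topologies\<close>

text \<open>The preimage of the basic closed set given by \<open>E\<close> is the basic closed set
  given by the characteristic function of the complement of \<open>E\<close>.\<close>

lemma continuous_map_Z_ideal:
  "continuous_map (hull_kernel_topology X S) (stone_topology X) (Z_ideal X S)"
  unfolding continuous_map_closedin
proof (intro conjI allI impI)
  show "Z_ideal X S \<in> topspace (hull_kernel_topology X S) \<rightarrow> topspace (stone_topology X)"
    using Z_ideal_ultrafilter
    by (simp add: topspace_hull_kernel_topology[OF chi] topspace_stone_topology)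
  fix C assume "closedin (stone_topology X) C"
  then obtain \<E> where \<E>: "\<E> \<subseteq> sets X" "C = ultrafilters X \<inter> (\<Inter>E\<in>\<E>. {U \<in> ultrafilters X. E \<in> U})"
    unfolding closedin_stone_topology subset_image_iff by blast
  let ?f = "\<lambda>E. char_fun X (space X - E)"
  have "{M \<in> max_ideals X S. Z_ideal X S M \<in> C}
      = max_ideals X S \<inter> (\<Inter>f\<in>?f ` \<E>. {M \<in> max_ideals X S. f \<in> M})"
    using \<E> Z_ideal_ultrafilter Z_ideal_iff[OF max_idealsD(1)] by auto
  moreover have "(\<lambda>f. {M \<in> max_ideals X S. f \<in> M}) ` ?f ` \<E> \<subseteq> (\<lambda>f. {M \<in> max_ideals X S. f \<in> M}) ` S"
    using \<E>(1) char_fun_closed by (intro image_mono) auto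
  ultimately show "closedin (hull_kernel_topology X S)
      {M \<in> topspace (hull_kernel_topology X S). Z_ideal X S M \<in> C}"
    unfolding closedin_hull_kernel_topology[OF chi] topspace_hull_kernel_topology[OF chi]
    by blast
qed

lemma Z_ideal_image_hull:
  assumes J: "ideal J (ring_of X S)"
  shows "Z_ideal X S ` {M \<in> max_ideals X S. J \<subseteq> M} = {U \<in> ultrafilters X. Z_ideal X S J \<subseteq> U}"
proof (intro equalityI subsetI)
  fix U assume "U \<in> {U \<in> ultrafilters X. Z_ideal X S J \<subseteq> U}"
  then show "U \<in> Z_ideal X S ` {M \<in> max_ideals X S. J \<subseteq> M}"
    using Z_ideal_lift[OF J] by blast
qed (use Z_ideal_ultrafilter in \<open>auto simp: Z_ideal_def\<close>)

lemma Z_ideal_surj: "Z_ideal X S ` max_ideals X S = ultrafilters X"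
proof -
  \<comment> \<open>For the zero ideal the lifting condition is vacuous: a characteristic function
    vanishes only if its set is empty, so only the whole space occurs here.\<close>
  have "Z_ideal X S {\<zero>\<^bsub>ring_of X S\<^esub>} \<subseteq> U" if U: "U \<in> ultrafilters X" for U
  proof
    fix E assume "E \<in> Z_ideal X S {\<zero>\<^bsub>ring_of X S\<^esub>}"
    then have E: "E \<in> sets X" "char_fun X (space X - E) = char_fun X {}"
      using Z_ideal_iff[OF R.zeroideal] by (auto simp: char_fun_ops)
    have "space X - E = {}"
    proof (rule ccontr)
      assume "space X - E \<noteq> {}"
      then obtain x where "x \<in> space X - E" by blast
      then show False using fun_cong[OF E(2), of x] by (simp add: char_fun_def)
    qed
    then have "space X - E \<notin> U" using U by (auto simp only: ultrafilters_def set_filter_def mem_Collect_eq)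
    then show "E \<in> U" using ultrafilter_Compl_iff[OF U E(1)] by blast
  qed
  then have "ultrafilters X \<subseteq> Z_ideal X S ` max_ideals X S"
    using Z_ideal_lift[OF R.zeroideal] by blast
  then show ?thesis using Z_ideal_ultrafilter by blast
qed

lemma closed_map_Z_ideal:
  "closed_map (hull_kernel_topology X S) (stone_topology X) (Z_ideal X S)"
  unfolding closed_map_def
proof (intro allI impI)
  fix K assume "closedin (hull_kernel_topology X S) K"
  then obtain F where F: "F \<subseteq> S" "K = max_ideals X S \<inter> (\<Inter>f\<in>F. {M \<in> max_ideals X S. f \<in> M})"
    unfolding closedin_hull_kernel_topology[OF chi] subset_image_iff by blast
  \<comment> \<open>A maximal ideal contains \<open>F\<close> iff it contains the ideal generated by
    \<open>F\<close>, so every closed set is the hull of an ideal and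
    \<open>Z_ideal_image_hull\<close> applies.\<close>
  define J where "J = Idl\<^bsub>ring_of X S\<^esub> F"
  have J: "ideal J (ring_of X S)"
    unfolding J_def using F by (intro R.genideal_ideal) (simp add: carrier_ring_of)
  have "F \<subseteq> J" unfolding J_def using F by (intro R.genideal_self) (simp add: carrier_ring_of)
  moreover have "J \<subseteq> M" if "M \<in> max_ideals X S" "F \<subseteq> M" for M
    unfolding J_def using that max_idealsD(1) by (intro R.genideal_minimal)
  ultimately have "K = {M \<in> max_ideals X S. J \<subseteq> M}" using F(2) by blast
  then have "Z_ideal X S ` K
      = ultrafilters X \<inter> \<Inter>((\<lambda>E. {U \<in> ultrafilters X. E \<in> U}) ` Z_ideal X S J)"
    using Z_ideal_image_hull[OF J] by auto
  moreover have "(\<lambda>E. {U \<in> ultrafilters X. E \<in> U}) ` Z_ideal X S J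
      \<subseteq> (\<lambda>E. {U \<in> ultrafilters X. E \<in> U}) ` sets X"
    using Z_ideal_iff[OF J] by (intro image_mono) blast
  ultimately show "closedin (stone_topology X) (Z_ideal X S ` K)"
    unfolding closedin_stone_topology by blast
qed

lemma quotient_map_Z_ideal:
  "quotient_map (hull_kernel_topology X S) (stone_topology X) (Z_ideal X S)"
  by (rule continuous_closed_imp_quotient_map[OF continuous_map_Z_ideal closed_map_Z_ideal])
    (simp add: topspace_hull_kernel_topology[OF chi] topspace_stone_topology Z_ideal_surj)

section \<open>Passage to the quotient space\<close>

lemma inj_on_Z_quot: "inj_on (Z_quot X S) (max_ideals X S // Z_rel X S)"
proof (rule inj_onI)
  fix c d assume "c \<in> max_ideals X S // Z_rel X S" "d \<in> max_ideals X S // Z_rel X S"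
    and eq: "Z_quot X S c = Z_quot X S d"
  then obtain M N where M: "M \<in> max_ideals X S" "c = Z_rel X S `` {M}"
    and N: "N \<in> max_ideals X S" "d = Z_rel X S `` {N}" by (auto elim!: quotientE)
  then have "Z_ideal X S M = Z_ideal X S N" using eq Z_quot_class by metis
  then have "(M, N) \<in> Z_rel X S" using M(1) N(1) by (simp add: Z_rel_def)
  then show "c = d" using M N equiv_class_eq[OF equiv_Z_rel] by simp
qed

end

theorem theorem3p3:
  fixes X :: "'a measure" and S :: "('a \<Rightarrow> real) set"
  assumes "space X \<noteq> {}"
    and "chi_ring X S"
  shows "homeomorphic_map
           (quotient_topology (hull_kernel_topology X S) (Z_rel X S))
           (stone_topology X)
           (Z_quot X S)"
proof -
  note S = assms(2)
  let ?H = "hull_kernel_topology X S" and ?r = "Z_rel X S"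
  let ?Q = "quotient_topology ?H ?r" and ?p = "\<lambda>M. Z_rel X S `` {M}"
  have p: "quotient_map ?H ?Q ?p" by (rule quotient_map_quotient_topology)
  \<comment> \<open>On maximal ideals the composite is \<open>Z_ideal X S\<close>. Since it is a
    quotient map, so is its second factor \<open>Z_quot X S\<close>; an injective quotient map is a
    homeomorphism.\<close>
  have q: "quotient_map ?H (stone_topology X) (Z_quot X S \<circ> ?p)"
    by (rule quotient_map_eq[OF quotient_map_Z_ideal[OF S]])
      (simp add: topspace_hull_kernel_topology[OF S] Z_quot_class)
  have "continuous_map ?Q (stone_topology X) (Z_quot X S)"
    by (rule continuous_compose_quotient_map[OF p quotient_imp_continuous_map[OF q]])
  then have "quotient_map ?Q (stone_topology X) (Z_quot X S)"
    by (rule quotient_map_from_composition[OF quotient_imp_continuous_map[OF p] _ q])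
  moreover have "inj_on (Z_quot X S) (topspace ?Q)"
    using inj_on_Z_quot[OF S]
    by (simp add: topspace_quotient_topology topspace_hull_kernel_topology[OF S])
  ultimately show ?thesis by (simp add: homeomorphic_map_def)
qed

end
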